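(* Let $D$ be a division ring with center $F$ and let $L$ be a maximal subfield of $D$. If there exists a non-trivial automorphism $\sigma\in\mathrm{Aut}(L)$ such that $x^{-1}\sigma(x)\in F$ for every $x\in L^*=L\setminus\{0\}$, then $D$ is commutative.
   Context: A maximal subfield of a division ring $D$ with center $F$ is a field $K\subseteq D$ containing $F$ such that $C_D(K)=K$, where $C_D(K)=\{d\in D: da=ad \text{ for all } a\in K\}$ is the centralizer of $K$ in $D$. $\mathrm{Aut}(L)$ denotes the group of field automorphisms of $L$; non-trivial means different from the identity. No finite-dimensionality of $D$ over $F$ is assumed. *)

theory Defs
  imports "HOL-Algebra.Subrings"
begin

(* No separate non-triviality axiom: the one of a ring is a unit, so skew_field_Units implies that it
   differs from the zero. *)
locale skew_field = ring R for R (structure) +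
  assumes skew_field_Units: "Units R = carrier R - {\<zero>}"

lemma skew_field_and_cring_iff_field: "skew_field R \<and> cring R \<longleftrightarrow> field R"
proof
  assume R: "skew_field R \<and> cring R"
  then show "field R"
    using cring.cring_fieldI skew_field.skew_field_Units by blast
next
  assume "field R"
  then interpret field R .
  show "skew_field R \<and> cring R"
    using field_Units by (intro conjI) (unfold_locales)
qed

definition centralizer :: "('a, 'b) ring_scheme \<Rightarrow> 'a set \<Rightarrow> 'a set" where
  "centralizer R K = {d \<in> carrier R. \<forall>a\<in>K. d \<otimes>\<^bsub>R\<^esub> a = a \<otimes>\<^bsub>R\<^esub> d}"

definition center :: "('a, 'b) ring_scheme \<Rightarrow> 'a set" where
  "center R = {z \<in> carrier R. \<forall>x\<in>carrier R. z \<otimes>\<^bsub>R\<^esub> x = x \<otimes>\<^bsub>R\<^esub> z}"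

definition maximal_subfield :: "'a set \<Rightarrow> ('a, 'b) ring_scheme \<Rightarrow> bool" where
  "maximal_subfield K R \<longleftrightarrow> subfield K R \<and> center R \<subseteq> K \<and> centralizer R K = K"

(* HOL functions are total, so an automorphism is represented by any map whose restriction to K
   is one; its values outside K are irrelevant, and two automorphisms have to be compared on K
   only. *)
definition subfield_auts :: "'a set \<Rightarrow> ('a, 'b) ring_scheme \<Rightarrow> ('a \<Rightarrow> 'a) set" where
  "subfield_auts K R = ring_iso (R\<lparr>carrier := K\<rparr>) (R\<lparr>carrier := K\<rparr>)"

end

theory Submission
  imports Defs
begin

text \<open>
  Let \<open>F\<close> be the center and write \<open>\<sigma> x = a\<^sub>x x\<close> with \<open>a\<^sub>x \<in> F\<close> for nonzero \<open>x \<in> L\<close>.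
  Applying \<open>\<sigma>\<close> to \<open>1 + x\<close> in two ways gives \<open>1 + a\<^sub>x x = b (1 + x)\<close> with \<open>b = a\<^bsub>1+x\<^esub>\<close>, a linear
  relation between \<open>1\<close> and \<open>x\<close> with coefficients in \<open>F\<close>. If \<open>x \<notin> F\<close>, then \<open>1\<close> and \<open>x\<close> are
  linearly independent over \<open>F\<close>, so \<open>a\<^sub>x = b = 1\<close> (lemma \<open>central_coeff_eq_one\<close>). Hence \<open>\<sigma>\<close> fixes
  every element of \<open>L\<close> outside \<open>F\<close>.

  If there is some \<open>y \<in> L - F\<close>, then \<open>\<sigma>\<close> also fixes each \<open>c \<in> F\<close>, because both \<open>y\<close> and \<open>c + y\<close>
  lie in \<open>L - F\<close>, and so \<open>\<sigma>\<close> is trivial on \<open>L\<close>. A non-trivial \<open>\<sigma>\<close> therefore forces \<open>L = F\<close>, and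
  maximality gives \<open>L = C\<^sub>D(L) = C\<^sub>D(F) = D\<close>: everything in \<open>D\<close> is central.
\<close>

lemma (in ring) center_minus_closed:
  assumes "a \<in> center R" "b \<in> center R"
  shows "a \<ominus> b \<in> center R"
  using assms by (auto simp: center_def a_minus_def l_distr r_distr l_minus r_minus)

text \<open>
  The center of a skew field is closed under division; commuting \<open>d\<close> past \<open>a \<otimes> x\<close> and cancelling
  \<open>a\<close> shows this without computing with inverses.
\<close>

lemma (in skew_field) center_cancel_left:
  assumes a: "a \<in> center R" "a \<noteq> \<zero>" and x: "x \<in> carrier R" and ax: "a \<otimes> x \<in> center R"
  shows "x \<in> center R"
proof -
  have aR: "a \<in> carrier R" and aU: "a \<in> Units R"
    using a by (auto simp: center_def skew_field_Units)
  have "x \<otimes> d = d \<otimes> x" if d: "d \<in> carrier R" for d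
  proof -
    have "a \<otimes> (x \<otimes> d) = (a \<otimes> x) \<otimes> d"
      using aR x d by (simp add: m_assoc)
    also have "\<dots> = d \<otimes> (a \<otimes> x)"
      using ax d by (simp add: center_def)
    also have "\<dots> = (d \<otimes> a) \<otimes> x"
      using aR x d by (simp add: m_assoc)
    also have "\<dots> = a \<otimes> (d \<otimes> x)"
      using a(1) aR x d by (simp add: center_def m_assoc)
    finally show ?thesis
      using aU x d by (simp add: Units_l_cancel)
  qed
  then show ?thesis
    using x by (simp add: center_def)
qed

text \<open>
  This is the linear independence of \<open>\<one>\<close> and \<open>x\<close> over the center: the relation rearranges to
  \<open>(a \<ominus> b) \<otimes> x = b \<ominus> \<one>\<close>, whose right-hand side is central, so \<open>a \<noteq> b\<close> would make \<open>x\<close> central.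
\<close>

lemma (in skew_field) central_coeff_eq_one:
  assumes a: "a \<in> center R" and b: "b \<in> center R"
    and x: "x \<in> carrier R" "x \<notin> center R"
    and rel: "\<one> \<oplus> a \<otimes> x = b \<otimes> (\<one> \<oplus> x)"
  shows "a = \<one>"
proof -
  have aR: "a \<in> carrier R" and bR: "b \<in> carrier R"
    using a b by (auto simp: center_def)
  have "(a \<ominus> b) \<otimes> x = \<ominus> \<one> \<oplus> (\<one> \<oplus> a \<otimes> x) \<ominus> b \<otimes> x"
    using aR bR x(1) by (simp add: a_minus_def l_distr l_minus r_neg1 a_assoc[symmetric] l_neg)
  also have "\<dots> = \<ominus> \<one> \<oplus> (b \<oplus> b \<otimes> x) \<ominus> b \<otimes> x"
    using bR x(1) by (simp add: rel r_distr)
  also have "\<dots> = \<ominus> \<one> \<oplus> b"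
    using bR x(1) by (simp add: a_minus_def a_assoc r_neg)
  also have "\<dots> = b \<ominus> \<one>"
    using bR by (simp add: a_minus_def a_comm)
  finally have eq: "(a \<ominus> b) \<otimes> x = b \<ominus> \<one>" .
  have "\<one> \<in> center R"
    by (simp add: center_def)
  then have "(a \<ominus> b) \<otimes> x \<in> center R"
    using b by (simp add: eq center_minus_closed)
  then have ab: "a \<ominus> b = \<zero>"
    using center_cancel_left[OF center_minus_closed[OF a b]] x by blast
  then have "b \<ominus> \<one> = \<zero>"
    using eq x(1) by simp
  then show ?thesis
    using ab aR bR by (metis one_closed r_right_minus_eq)
qed

theorem theorem3:
  fixes D :: "('a, 'b) ring_scheme" (structure) and L :: "'a set"
  assumes "skew_field D"
    and "maximal_subfield L D"
    and "\<exists>\<sigma>\<in>subfield_auts L D.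
           (\<exists>x\<in>L. \<sigma> x \<noteq> x) \<and> (\<forall>x\<in>L - {\<zero>}. inv x \<otimes> \<sigma> x \<in> center D)"
  shows "cring D"
proof -
  interpret skew_field D by fact
  obtain \<sigma> where \<sigma>: "\<sigma> \<in> subfield_auts L D" and nontriv: "\<exists>x\<in>L. \<sigma> x \<noteq> x"
    and ratio: "\<And>x. x \<in> L \<Longrightarrow> x \<noteq> \<zero> \<Longrightarrow> inv x \<otimes> \<sigma> x \<in> center D"
    using assms(3) by blast
  have L: "subring L D" and FL: "center D \<subseteq> L" and CL: "centralizer D L = L"
    using assms(2) by (auto simp: maximal_subfield_def intro: subfieldE(1))
  have LD: "x \<in> carrier D" if "x \<in> L" for x
    using subringE(1)[OF L] that by blast
  have one_L: "\<one> \<in> L" and add_L: "\<And>x y. x \<in> L \<Longrightarrow> y \<in> L \<Longrightarrow> x \<oplus> y \<in> L"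
    using subringE(3,7)[OF L] by auto
  have \<sigma>_L: "\<sigma> x \<in> L" if "x \<in> L" for x
    using \<sigma> that by (auto simp: subfield_auts_def ring_iso_def ring_hom_def)
  have \<sigma>_add: "\<sigma> (x \<oplus> y) = \<sigma> x \<oplus> \<sigma> y" if "x \<in> L" "y \<in> L" for x y
    using \<sigma> that by (auto simp: subfield_auts_def ring_iso_def ring_hom_def)
  have \<sigma>_one: "\<sigma> \<one> = \<one>"
    using \<sigma> by (auto simp: subfield_auts_def ring_iso_def ring_hom_def)
  have central_factor: "\<exists>a\<in>center D. \<sigma> x = a \<otimes> x" if x: "x \<in> L" "x \<noteq> \<zero>" for x
  proof
    show a: "inv x \<otimes> \<sigma> x \<in> center D"
      using ratio x .
    have xU: "x \<in> Units D"
      using x LD by (simp add: skew_field_Units)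
    have "(inv x \<otimes> \<sigma> x) \<otimes> x = x \<otimes> (inv x \<otimes> \<sigma> x)"
      using a LD[OF x(1)] by (simp add: center_def)
    also have "\<dots> = \<sigma> x"
      using xU LD[OF x(1)] LD[OF \<sigma>_L[OF x(1)]] by (simp add: m_assoc[symmetric])
    finally show "\<sigma> x = (inv x \<otimes> \<sigma> x) \<otimes> x" by simp
  qed
  have fixed_off_center: "\<sigma> x = x" if x: "x \<in> L" "x \<notin> center D" for x
  proof -
    have zero_F: "\<zero> \<in> center D" and one_F: "\<one> \<in> center D"
      by (auto simp: center_def)
    have "\<one> \<oplus> x \<noteq> \<zero>"
      \<comment> \<open>otherwise \<open>x = \<ominus> \<one>\<close> would be central\<close>
      using x LD zero_F one_F center_minus_closed
      by (metis add.inv_comm add.inv_equality minus_eq l_zero a_inv_closed one_closed)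
    then obtain b where b: "b \<in> center D" "\<sigma> (\<one> \<oplus> x) = b \<otimes> (\<one> \<oplus> x)"
      using central_factor one_L add_L x(1) by blast
    obtain a where a: "a \<in> center D" "\<sigma> x = a \<otimes> x"
      using central_factor x zero_F by blast
    have "a = \<one>"
    proof (rule central_coeff_eq_one[OF a(1) b(1) LD[OF x(1)] x(2)])
      show "\<one> \<oplus> a \<otimes> x = b \<otimes> (\<one> \<oplus> x)"
        using \<sigma>_add[OF one_L x(1)] by (simp add: \<sigma>_one a(2) b(2))
    qed
    then show ?thesis
      using a(2) LD[OF x(1)] by simp
  qed
  have "L \<subseteq> center D"
  proof (rule ccontr)
    assume "\<not> L \<subseteq> center D"
    then obtain y where y: "y \<in> L" "y \<notin> center D" by blast
    have "\<sigma> c = c" if c: "c \<in> L" for c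
    proof (cases "c \<in> center D")
      case True
      have cy: "y = (c \<oplus> y) \<ominus> c"
        using LD c y(1) by (simp add: a_minus_def a_assoc a_comm r_neg1)
      have "c \<oplus> y \<notin> center D"
        using center_minus_closed[OF _ True, of "c \<oplus> y"] y(2) cy by auto
      then have "\<sigma> c \<oplus> y = c \<oplus> y"
        using fixed_off_center add_L \<sigma>_add[OF c y(1)] c y by simp
      then show ?thesis
        using LD \<sigma>_L c y(1) by simp
    qed (use c fixed_off_center in blast)
    then show False
      using nontriv by blast
  qed
  then have "carrier D \<subseteq> centralizer D L"
    by (auto simp: center_def centralizer_def)
  then have "carrier D \<subseteq> center D"
    using CL \<open>L \<subseteq> center D\<close> by blast
  then show ?thesis
    by unfold_locales (auto simp: center_def)
qed

end
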